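(* Let $A\in\mathcal{PC}_{n}$ with columns $a_1,\ldots,a_n$. Then the geometric mean of any collection of distinct columns of $A$ lies in $\mathcal{E}(A)$; that is, for every nonempty set $\{j_1,\ldots,j_s\}\subseteq\{1,\ldots,n\}$ of $s$ distinct indices, $$\left(a_{j_1}\circ a_{j_2}\circ\cdots\circ a_{j_s}\right)^{\left(\frac{1}{s}\right)}\in\mathcal{E}(A).$$
   Context: A reciprocal (pairwise comparison) matrix of order $n$ is an $n\times n$ real matrix $A=[a_{ij}]$ with all entries positive and $a_{ji}=1/a_{ij}$ for all $1\leq i,j\leq n$ (so its diagonal entries are $1$). The set of all such matrices is denoted $\mathcal{PC}_{n}$. A positive $n$-vector is a vector in $\mathbb{R}^n$ with all entries positive. For a positive $n$-vector $w=[w_1\ \cdots\ w_n]^T$, let $w^{(-T)}=[1/w_1\ \cdots\ 1/w_n]$ be the transpose of its entrywise inverse, so that $ww^{(-T)}=[w_i/w_j]$. For a matrix $B$, $|B|$ denotes the entrywise absolute value, and inequalities between matrices are entrywise. A positive $n$-vector $w$ is efficient for $A\in\mathcal{PC}_{n}$ if, for every positive $n$-vector $v$, the inequality $|vv^{(-T)}-A|\leq|ww^{(-T)}-A|$ implies that $v$ and $w$ are proportional. $\mathcal{E}(A)$ denotes the set of all (positive) vectors that are efficient for $A$. $\circ$ denotes the Hadamard (entrywise) product, and a superscript in parentheses denotes an exponent applied to every entry. The geometric mean of positive vectors $u_1,\ldots,u_k$ of the same size is the entrywise geometric mean $(u_1\circ u_2\circ\cdots\circ u_k)^{(1/k)}$.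 *)

theory Defs
  imports "HOL-Analysis.Analysis"
begin

text \<open>On \<open>real ^ 'n\<close> and \<open>real ^ 'n ^ 'n\<close> the library operations \<open>*\<close>, \<open>\<prod>\<close>, \<open>\<le>\<close> and \<open>\<bar>_\<bar>\<close> are
  all entrywise; in particular \<open>*\<close> is the Hadamard product.\<close>

definition reciprocal_matrices :: "(real ^ 'n ^ 'n) set" where
  "reciprocal_matrices = {A. \<forall>i j. A $ i $ j > 0 \<and> A $ j $ i = 1 / A $ i $ j}"

definition positive_vector :: "real ^ 'n \<Rightarrow> bool" where
  "positive_vector w \<longleftrightarrow> (\<forall>i. w $ i > 0)"

text \<open>The matrix \<open>w w\<^sup>(\<^sup>-\<^sup>T\<^sup>)\<close>.\<close>

definition ratio_matrix :: "real ^ 'n \<Rightarrow> real ^ 'n ^ 'n" where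
  "ratio_matrix w = (\<chi> i j. w $ i / w $ j)"

definition efficient_vectors :: "real ^ 'n ^ 'n \<Rightarrow> (real ^ 'n) set" where
  "efficient_vectors A = {w. positive_vector w \<and>
     (\<forall>v. positive_vector v \<longrightarrow> \<bar>ratio_matrix v - A\<bar> \<le> \<bar>ratio_matrix w - A\<bar> \<longrightarrow>
        (\<exists>c. v = c *\<^sub>R w))}"

definition hadamard_powr :: "real ^ 'n \<Rightarrow> real \<Rightarrow> real ^ 'n" where
  "hadamard_powr u r = (\<chi> i. u $ i powr r)"

definition geometric_mean :: "('a \<Rightarrow> real ^ 'n) \<Rightarrow> 'a set \<Rightarrow> real ^ 'n" where
  "geometric_mean u J = hadamard_powr (\<Prod>j\<in>J. u j) (1 / real (card J))"

end

theory Submission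
  imports Defs
begin

text \<open>
  Draw an edge from \<open>i\<close> to \<open>j\<close> whenever \<open>w\<^sub>i / w\<^sub>j \<ge> a\<^sub>i\<^sub>j\<close>. If \<open>v\<close> approximates \<open>A\<close> at least as well
  as \<open>w\<close> in every entry, then along such an edge \<open>v\<^sub>i / v\<^sub>j\<close> cannot exceed \<open>w\<^sub>i / w\<^sub>j\<close>, so the quotient
  \<open>v\<^sub>i / w\<^sub>i\<close> does not decrease. The indices where this quotient is maximal therefore form a set
  that no edge leaves. If every nonempty proper set of indices is left by some edge (that is, if
  the digraph is strongly connected), the quotient must be constant, and \<open>w\<close> is efficient
  (\<open>efficient_vectors_if_edge_leaves_every_cut\<close>).

  It remains to see that the geometric mean \<open>w\<close> of the columns in \<open>J\<close> has such an edge out of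
  every cut. Taking logarithms, there is an edge from \<open>i\<close> to \<open>j\<close> iff
  \<open>c\<^sub>i\<^sub>j = ln w\<^sub>i - ln w\<^sub>j - ln a\<^sub>i\<^sub>j\<close> is nonnegative. The matrix \<open>c\<close> is skew-symmetric, and since
  \<open>ln w\<^sub>i\<close> is the mean of \<open>ln a\<^sub>i\<^sub>j\<close> over \<open>j \<in> J\<close>, the sum of each of its rows over \<open>J\<close> vanishes
  (\<open>skew_centred_row_sum\<close>). These two properties alone forbid that \<open>c\<close> is negative on all of
  \<open>S \<times> -S\<close> (\<open>skew_zero_row_sums_imp_nonneg_across_cut\<close>).
\<close>

lemma sum_skew_square_eq_0:
  fixes c :: "'a \<Rightarrow> 'a \<Rightarrow> real"
  assumes "\<And>i j. c j i = - c i j"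
  shows "(\<Sum>i\<in>T. \<Sum>j\<in>T. c i j) = 0"
proof -
  have "(\<Sum>i\<in>T. \<Sum>j\<in>T. c i j) = (\<Sum>i\<in>T. \<Sum>j\<in>T. c j i)"
    by (rule sum.swap)
  also have "\<dots> = (\<Sum>i\<in>T. \<Sum>j\<in>T. - c i j)"
    by (intro sum.cong refl assms)
  also have "\<dots> = - (\<Sum>i\<in>T. \<Sum>j\<in>T. c i j)"
    by (simp add: sum_negf)
  finally show ?thesis by simp
qed

text \<open>
  If \<open>J\<close> meets both \<open>S\<close> and its complement, adding the rows in \<open>J \<inter> S\<close> cancels the entries
  inside \<open>J \<inter> S\<close> by skew-symmetry and leaves the entries across the cut, which thus add up to 0.
  If \<open>J\<close> lies on one side of the cut, a single row on the other side suffices.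
\<close>

lemma skew_zero_row_sums_imp_nonneg_across_cut:
  fixes c :: "'a \<Rightarrow> 'a \<Rightarrow> real"
  assumes skew: "\<And>i j. c j i = - c i j"
    and row: "\<And>i. (\<Sum>j\<in>J. c i j) = 0"
    and J: "finite J" "J \<noteq> {}"
    and S: "S \<noteq> {}" "S \<noteq> UNIV"
  shows "\<exists>i\<in>S. \<exists>j\<in>-S. c i j \<ge> 0"
proof (rule ccontr)
  assume "\<not> ?thesis"
  then have neg: "c i j < 0" if "i \<in> S" "j \<notin> S" for i j
    using that by (meson ComplI not_le)
  consider "J \<inter> S = {}" | "J \<subseteq> S" | "J \<inter> S \<noteq> {}" "J - S \<noteq> {}"
    by blast
  then show False
  proof cases
    case 1
    obtain i where "i \<in> S" using S by blast
    then have "(\<Sum>j\<in>J. c i j) < (\<Sum>j\<in>J. 0)"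
      using 1 J neg by (intro sum_strict_mono) auto
    then show False using row[of i] by simp
  next
    case 2
    obtain j where "j \<notin> S" using S by blast
    then have "c j i > 0" if "i \<in> J" for i
      using 2 that neg[of i j] skew[of j i] by auto
    then have "(\<Sum>i\<in>J. 0) < (\<Sum>i\<in>J. c j i)"
      using J by (intro sum_strict_mono) auto
    then show False using row[of j] by simp
  next
    case 3
    have split: "(\<Sum>j\<in>J. c i j) = (\<Sum>j\<in>J \<inter> S. c i j) + (\<Sum>j\<in>J - S. c i j)" for i
      using J(1) by (rule sum.Int_Diff)
    have "0 = (\<Sum>i\<in>J \<inter> S. \<Sum>j\<in>J. c i j)"
      using row by simp
    also have "\<dots> = (\<Sum>i\<in>J \<inter> S. \<Sum>j\<in>J - S. c i j)"
      using sum_skew_square_eq_0[of c "J \<inter> S", OF skew] by (simp add: split sum.distrib)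
    also have "\<dots> < (\<Sum>i\<in>J \<inter> S. \<Sum>j\<in>J - S. 0)"
      using J 3 neg by (intro sum_strict_mono) auto
    finally show False by simp
  qed
qed

text \<open>
  Subtracting from a skew-symmetric matrix the differences of its row means over \<open>J\<close> annihilates
  every row sum over \<open>J\<close>, also for rows outside \<open>J\<close>, because the means of the rows in \<open>J\<close> add up
  to 0.
\<close>

lemma skew_centred_row_sum:
  fixes b :: "'a \<Rightarrow> 'a \<Rightarrow> real"
  assumes skew: "\<And>i j. b j i = - b i j"
    and J: "finite J" "J \<noteq> {}"
    and x: "\<And>i. x i = (\<Sum>j\<in>J. b i j) / card J"
  shows "(\<Sum>j\<in>J. x i - x j - b i j) = 0"
proof -
  have "(\<Sum>j\<in>J. x j) = 0"
    using sum_skew_square_eq_0[of b J, OF skew] by (simp add: x flip: sum_divide_distrib)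
  moreover have "card J * x i = (\<Sum>j\<in>J. b i j)"
    using J by (simp add: x)
  ultimately show ?thesis
    by (simp add: sum_subtractf)
qed

text \<open>
  The cut to look at consists of the indices where \<open>v\<^sub>i / w\<^sub>i\<close> is maximal: along an
  edge the quotient does not decrease, so the edge ends at an index where it is maximal again.
\<close>

lemma efficient_vectors_if_edge_leaves_every_cut:
  fixes A :: "real ^ 'n ^ 'n"
  assumes w: "positive_vector w"
    and edge: "\<And>S. S \<noteq> {} \<Longrightarrow> S \<noteq> UNIV \<Longrightarrow> \<exists>i\<in>S. \<exists>j\<in>-S. w $ i / w $ j \<ge> A $ i $ j"
  shows "w \<in> efficient_vectors A"
  unfolding efficient_vectors_def
proof (intro CollectI conjI allI impI w)
  fix v
  assume v: "positive_vector v" and le: "\<bar>ratio_matrix v - A\<bar> \<le> \<bar>ratio_matrix w - A\<bar>"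
  have wpos: "w $ i > 0" and vpos: "v $ i > 0" for i
    using v w by (auto simp: positive_vector_def)
  have closer: "\<bar>v $ i / v $ j - A $ i $ j\<bar> \<le> \<bar>w $ i / w $ j - A $ i $ j\<bar>" for i j
    using le by (simp add: less_eq_vec_def ratio_matrix_def abs_vec_def)
  define z where "z i = v $ i / w $ i" for i
  have mono: "z i \<le> z j" if "w $ i / w $ j \<ge> A $ i $ j" for i j
  proof -
    have "v $ i / v $ j \<le> w $ i / w $ j"
      using closer[of i j] that by linarith
    then show ?thesis
      using wpos[of i] wpos[of j] vpos[of j] by (simp add: z_def field_simps)
  qed
  define m where "m = Max (range z)"
  define S where "S = {i. z i = m}"
  have z_le: "z i \<le> m" for i
    by (simp add: m_def)
  have "m \<in> range z"
    unfolding m_def by (intro Max_in) auto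
  then have "S \<noteq> {}"
    by (auto simp: S_def)
  moreover have "\<not> (\<exists>i\<in>S. \<exists>j\<in>-S. w $ i / w $ j \<ge> A $ i $ j)"
    unfolding S_def using mono z_le by (metis (full_types) ComplD antisym mem_Collect_eq)
  ultimately have "S = UNIV"
    using edge by blast
  then have "z i = m" for i
    by (auto simp: S_def)
  then have "v $ i = m * w $ i" for i
    using wpos[of i] by (metis z_def nonzero_divide_eq_eq less_irrefl)
  then show "\<exists>c. v = c *\<^sub>R w"
    by (intro exI[of _ m]) (simp add: vec_eq_iff)
qed

lemma geometric_mean_nth:
  "geometric_mean u J $ i = (\<Prod>j\<in>J. u j $ i) powr (1 / card J)"
proof -
  have "(\<Prod>j\<in>J. u j) $ i = (\<Prod>j\<in>J. u j $ i)"
    by (induction J rule: infinite_finite_induct) auto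
  then show ?thesis
    by (simp add: geometric_mean_def hadamard_powr_def)
qed

theorem theorem12:
  fixes A :: "real ^ 'n ^ 'n" and J :: "'n set"
  assumes "A \<in> reciprocal_matrices"
    and "J \<noteq> {}"
  shows "geometric_mean (\<lambda>j. column j A) J \<in> efficient_vectors A"
proof -
  define w where "w = geometric_mean (\<lambda>j. column j A) J"
  define b where "b i j = ln (A $ i $ j)" for i j
  define x where "x i = ln (w $ i)" for i
  have Apos: "A $ i $ j > 0" and Arec: "A $ j $ i = 1 / A $ i $ j" for i j
    using assms(1) unfolding reciprocal_matrices_def by blast+
  have w_nth: "w $ i = (\<Prod>j\<in>J. A $ i $ j) powr (1 / card J)" for i
    by (simp add: w_def geometric_mean_nth column_def)
  have row_prod_pos: "(\<Prod>j\<in>J. A $ i $ j) > 0" for i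
    using Apos by (intro prod_pos) auto
  have wpos: "w $ i > 0" for i
    unfolding w_nth using row_prod_pos[of i] by (metis powr_gt_zero less_irrefl)
  have skew: "b j i = - b i j" for i j
    unfolding b_def Arec[of j i] using Apos[of j i] by (simp add: ln_div)
  have x_mean: "x i = (\<Sum>j\<in>J. b i j) / card J" for i
  proof -
    have nz: "A $ i $ j \<noteq> 0" for j
      using Apos[of i j] by simp
    then show ?thesis
      using Apos row_prod_pos[of i] by (simp add: x_def w_nth b_def ln_prod)
  qed
  have "\<exists>i\<in>S. \<exists>j\<in>-S. w $ i / w $ j \<ge> A $ i $ j" if S: "S \<noteq> {}" "S \<noteq> UNIV" for S
  proof -
    have "\<exists>i\<in>S. \<exists>j\<in>-S. x i - x j - b i j \<ge> 0"
    proof (rule skew_zero_row_sums_imp_nonneg_across_cut)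
      show "x j - x i - b j i = - (x i - x j - b i j)" for i j
        using skew[of i j] by simp
      show "(\<Sum>j\<in>J. x i - x j - b i j) = 0" for i
        using skew_centred_row_sum[of b J x, OF skew _ assms(2) x_mean] by simp
    qed (use assms(2) S in auto)
    moreover have "w $ i / w $ j \<ge> A $ i $ j" if "x i - x j - b i j \<ge> 0" for i j
    proof -
      have "ln (A $ i $ j) \<le> ln (w $ i / w $ j)"
        using that wpos[of i] wpos[of j] by (simp add: x_def b_def ln_div)
      then show ?thesis
        using Apos[of i j] wpos[of i] wpos[of j] by simp
    qed
    ultimately show ?thesis by blast
  qed
  moreover have "positive_vector w"
    using wpos by (simp add: positive_vector_def)
  ultimately show ?thesis
    using efficient_vectors_if_edge_leaves_every_cut unfolding w_def by blast
qed

end
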